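(* Let $\mathbb{F}$ be a field, $A\in\mathbb{F}^{n\times n}$, $Z$ a zero forcing set of $A$ with a fixed chronological list of forces $\pi$ and terminal set $T$, and let $B\in\mathbb{F}^{T\times Z}$ be the core matrix of $A$. Let $b\in\mathbb{F}^n$ be such that $Ax=b$ has at least one solution. If $y\in\mathbb{F}^Z$ satisfies $By=R(b)_T$, then there exists $x\in\mathbb{F}^n$ with $Ax=b$ and $x_Z=y$.
   Context: Let $G=(V,E)$, $V=[n]$, be the directed graph with $(u,v)\in E$ iff $u\neq v$ and $A_{u,v}\neq0$. Zero forcing: starting from a blue set $Z$, a blue vertex with exactly one non-blue out-neighbour $u$ forces $u$ (colours it blue); $Z$ is a zero forcing set if this eventually colours all of $V$ blue. A chronological list of forces $\pi$ is an ordering $u_1,\dots,u_{n-|Z|}$ of $V\setminus Z$ together with, for each $u_i$, a forcing parent $u_i^{\uparrow}\in Z\cup\{u_1,\dots,u_{i-1}\}$ such that $u_i$ is the only out-neighbour of $u_i^{\uparrow}$ outside $Z\cup\{u_1,\dots,u_{i-1}\}$ (so $A_{u_i^{\uparrow},u_i}\neq0$). A vertex is a terminal if it is the forcing parent of no vertex; $T$ is the set of terminals (and $|T|=|Z|$). The procedure $\textsc{Forcing}(A,Z,b)$: set $x\gets0$; for each $u\in V\setminus Z$ in the order $\pi$, set $x_u\gets (b_{u^{\uparrow}}-A_{u^{\uparrow},*}x)/A_{u^{\uparrow},u}$, where $A_{w,*}$ is row $w$ of $A$; return $x$. Let $R(b)=b-A\,\textsc{Forcing}(A,Z,b)$, a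 linear map. The core matrix of $A$ is $B=(RA)_{T,Z}$, i.e. the matrix with rows indexed by $T$, columns indexed by $Z$, whose column $v\in Z$ is $R(a_v)_T$ where $a_v$ is the $v$-th column of $A$. For a vector $w$ and index set $I$, $w_I$ is the restriction of $w$ to $I$. *)

theory Defs
  imports Jordan_Normal_Form.Matrix "HOL-Library.FuncSet"
begin

(* For an n x n matrix the vertex set is {0..<n}, matching the 0-based indexing of type mat. *)
definition verts :: "'a mat \<Rightarrow> nat set" where
  "verts A = {0..<dim_row A}"

definition arcs :: "'a::zero mat \<Rightarrow> (nat \<times> nat) set" where
  "arcs A = {(u, v). u \<in> verts A \<and> v \<in> verts A \<and> u \<noteq> v \<and> A $$ (u, v) \<noteq> 0}"

definition out_nbrs :: "'a::zero mat \<Rightarrow> nat \<Rightarrow> nat set" where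
  "out_nbrs A u = arcs A `` {u}"

(* One force: S and S' are the blue sets before and after. *)
definition force_step :: "'a::zero mat \<Rightarrow> nat set \<Rightarrow> nat set \<Rightarrow> bool" where
  "force_step A S S' \<longleftrightarrow> (\<exists>w\<in>S. \<exists>u. out_nbrs A w - S = {u} \<and> S' = insert u S)"

definition zero_forcing_set :: "'a::zero mat \<Rightarrow> nat set \<Rightarrow> bool" where
  "zero_forcing_set A Z \<longleftrightarrow> Z \<subseteq> verts A \<and> (force_step A)\<^sup>*\<^sup>* Z (verts A)"

(* The i-th entry of the list is the pair (forcing parent of u_i, u_i). *)
definition chronological_forces ::
    "'a::zero mat \<Rightarrow> nat set \<Rightarrow> (nat \<times> nat) list \<Rightarrow> bool" where
  "chronological_forces A Z \<pi> \<longleftrightarrow>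
     distinct (map snd \<pi>) \<and> set (map snd \<pi>) = verts A - Z \<and>
     (\<forall>i < length \<pi>. let S = Z \<union> set (map snd (take i \<pi>)) in
        fst (\<pi> ! i) \<in> S \<and> out_nbrs A (fst (\<pi> ! i)) - S = {snd (\<pi> ! i)})"

definition terminals :: "'a mat \<Rightarrow> (nat \<times> nat) list \<Rightarrow> nat set" where
  "terminals A \<pi> = verts A - set (map fst \<pi>)"

definition forcing_update ::
    "'a::field mat \<Rightarrow> 'a vec \<Rightarrow> nat \<times> nat \<Rightarrow> 'a vec \<Rightarrow> 'a vec" where
  "forcing_update A b = (\<lambda>(p, u) x.
     vec (dim_vec x) (\<lambda>i. if i = u then (b $ p - row A p \<bullet> x) / A $$ (p, u) else x $ i))"

(* Z enters only through \<pi>, whose second components enumerate the vertices outside Z. *)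
definition forcing :: "'a::field mat \<Rightarrow> (nat \<times> nat) list \<Rightarrow> 'a vec \<Rightarrow> 'a vec" where
  "forcing A \<pi> b = fold (forcing_update A b) \<pi> (0\<^sub>v (dim_col A))"

definition residual :: "'a::field mat \<Rightarrow> (nat \<times> nat) list \<Rightarrow> 'a vec \<Rightarrow> 'a vec" where
  "residual A \<pi> b = b - A *\<^sub>v forcing A \<pi> b"

(* Vectors and matrices indexed by sets of vertices, such as elements of F^Z and F^(T x Z),
   are extensional functions: they are undefined outside their index set. *)
definition restrict_vec :: "'a vec \<Rightarrow> nat set \<Rightarrow> nat \<Rightarrow> 'a" where
  "restrict_vec w I = (\<lambda>i\<in>I. w $ i)"

definition core_matrix ::
    "'a::field mat \<Rightarrow> nat set \<Rightarrow> (nat \<times> nat) list \<Rightarrow> nat \<Rightarrow> nat \<Rightarrow> 'a" where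
  "core_matrix A Z \<pi> = (\<lambda>t\<in>terminals A \<pi>. \<lambda>v\<in>Z. residual A \<pi> (col A v) $ t)"

definition mult_indexed ::
    "nat set \<Rightarrow> nat set \<Rightarrow> (nat \<Rightarrow> nat \<Rightarrow> 'a::field) \<Rightarrow> (nat \<Rightarrow> 'a) \<Rightarrow> nat \<Rightarrow> 'a" where
  "mult_indexed I J M y = (\<lambda>i\<in>I. \<Sum>j\<in>J. M i j * y j)"

end

theory Submission
  imports Defs
begin

text \<open>
  Each force makes the equation at the forcing parent hold, and no later force disturbs it, because
  a parent has no out-neighbours among the vertices forced afterwards. Hence every residual is
  supported on the terminals. Let \<open>h\<close> be the extension of \<open>y\<close> by zero. Since the residual is linear,
  \<open>R (A h)\<close> agrees on the terminals with \<open>B y = R b\<close>, so \<open>R (b - A h) = 0\<close>. This says that forcing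
  solves \<open>A z = b - A h\<close>, and \<open>z\<close> vanishes on \<open>Z\<close>; thus \<open>x = h + z\<close> is the desired solution.
\<close>

section \<open>Dimensions, and how one force changes row products\<close>

lemma dim_vec_forcing_update [simp]: "dim_vec (forcing_update A b e x) = dim_vec x"
  by (cases e) (simp add: forcing_update_def)

lemma dim_vec_fold_forcing_update [simp]:
  "dim_vec (fold (forcing_update A b) es x) = dim_vec x"
  by (induction es arbitrary: x) auto

lemma dim_vec_forcing [simp]: "dim_vec (forcing A \<pi> b) = dim_col A"
  by (simp add: forcing_def)

lemma forcing_update_carrier [simp]:
  "x \<in> carrier_vec n \<Longrightarrow> forcing_update A b e x \<in> carrier_vec n"
  by (rule carrier_vecI) simp

lemma forcing_carrier [simp]:
  "A \<in> carrier_mat n n \<Longrightarrow> forcing A \<pi> b \<in> carrier_vec n"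
  by (rule carrier_vecI) simp

lemma forcing_update_index:
  "i < dim_vec x \<Longrightarrow> forcing_update A b (p, u) x $ i
     = (if i = u then (b $ p - row A p \<bullet> x) / A $$ (p, u) else x $ i)"
  by (simp add: forcing_update_def)

lemma dim_vec_residual [simp]: "dim_vec (residual A \<pi> b) = dim_row A"
  by (simp add: residual_def)

lemma residual_index:
  assumes "A \<in> carrier_mat n n" and "i < n"
  shows "residual A \<pi> b $ i = b $ i - row A i \<bullet> forcing A \<pi> b"
  using assms by (simp add: residual_def)

text \<open>Only coordinate \<open>u\<close> changes, so the product moves by
  \<open>A $$ (w, u)\<close> times that change. For \<open>w = p\<close> this will establish the row
  equation; for an earlier parent \<open>w\<close> the entry is 0 and its equation survives.\<close>

lemma scalar_prod_forcing_update:
  assumes "A \<in> carrier_mat n n" and "x \<in> carrier_vec n" and "w < n" and "u < n"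
  shows "row A w \<bullet> forcing_update A b (p, u) x
    = row A w \<bullet> x + A $$ (w, u) * ((b $ p - row A p \<bullet> x) / A $$ (p, u) - x $ u)"
proof -
  have "row A w \<bullet> forcing_update A b (p, u) x = (\<Sum>i<n. A $$ (w, i) *
      (x $ i + (if i = u then (b $ p - row A p \<bullet> x) / A $$ (p, u) - x $ u else 0)))"
    using assms by (auto simp: scalar_prod_def forcing_update_def lessThan_atLeast0 intro!: sum.cong)
  also have "\<dots> = (\<Sum>i<n. A $$ (w, i) * x $ i) + (\<Sum>i<n.
      if i = u then A $$ (w, i) * ((b $ p - row A p \<bullet> x) / A $$ (p, u) - x $ u) else 0)"
    by (subst sum.distrib[symmetric], rule sum.cong) (auto simp: algebra_simps)
  also have "(\<Sum>i<n. A $$ (w, i) * x $ i) = row A w \<bullet> x"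
    using assms by (simp add: scalar_prod_def lessThan_atLeast0)
  finally show ?thesis using assms by simp
qed

section \<open>Linearity of forcing and of the residual\<close>

text \<open>The divisor in an update is an entry of \<open>A\<close>, fixed in advance, so each
  update is linear in the pair (right-hand side, current vector). The start vectors are arbitrary
  because the induction continues from updated ones.\<close>

lemma fold_forcing_update_linear:
  assumes A: "A \<in> carrier_mat n n" and b: "b \<in> carrier_vec n" and c: "c \<in> carrier_vec n"
    and "x \<in> carrier_vec n" and "z \<in> carrier_vec n" and "\<forall>e\<in>set es. fst e < n"
  shows "fold (forcing_update A (b + k \<cdot>\<^sub>v c)) es (x + k \<cdot>\<^sub>v z)
    = fold (forcing_update A b) es x + k \<cdot>\<^sub>v fold (forcing_update A c) es z"
  using assms(4-)
proof (induction es arbitrary: x z)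
  case (Cons e es)
  obtain p u where e: "e = (p, u)" by (cases e)
  have "row A p \<bullet> (x + k \<cdot>\<^sub>v z) = row A p \<bullet> x + k * (row A p \<bullet> z)"
    using A Cons.prems scalar_prod_add_distrib[of "row A p" n x "k \<cdot>\<^sub>v z"] by (auto simp: e)
  then have "forcing_update A (b + k \<cdot>\<^sub>v c) e (x + k \<cdot>\<^sub>v z)
      = forcing_update A b e x + k \<cdot>\<^sub>v forcing_update A c e z"
    using A b c Cons.prems
    by (intro eq_vecI) (auto simp: e forcing_update_def diff_divide_distrib add_divide_distrib algebra_simps)
  then show ?case using Cons by simp
qed simp

lemma residual_linear:
  assumes A: "A \<in> carrier_mat n n" and b: "b \<in> carrier_vec n" and c: "c \<in> carrier_vec n"
    and \<pi>: "\<forall>e\<in>set \<pi>. fst e < n"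
  shows "residual A \<pi> (b + k \<cdot>\<^sub>v c) = residual A \<pi> b + k \<cdot>\<^sub>v residual A \<pi> c"
proof -
  have "k \<cdot>\<^sub>v 0\<^sub>v n = 0\<^sub>v n" by (intro eq_vecI) auto
  then have "forcing A \<pi> (b + k \<cdot>\<^sub>v c) = forcing A \<pi> b + k \<cdot>\<^sub>v forcing A \<pi> c"
    using fold_forcing_update_linear[OF A b c _ _ \<pi>, of "0\<^sub>v n" "0\<^sub>v n" k] A
    by (simp add: forcing_def)
  moreover have "row A i \<bullet> (forcing A \<pi> b + k \<cdot>\<^sub>v forcing A \<pi> c)
      = row A i \<bullet> forcing A \<pi> b + k * (row A i \<bullet> forcing A \<pi> c)" if "i < n" for i
    using A that scalar_prod_add_distrib[of "row A i" n "forcing A \<pi> b" "k \<cdot>\<^sub>v forcing A \<pi> c"]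
    by simp
  ultimately show ?thesis
    using A b c by (intro eq_vecI) (auto simp: residual_def algebra_simps)
qed

lemma residual_zero:
  assumes A: "A \<in> carrier_mat n n" and \<pi>: "\<forall>e\<in>set \<pi>. fst e < n"
  shows "residual A \<pi> (0\<^sub>v n) = 0\<^sub>v n"
proof -
  \<comment> \<open>With factor -1 linearity turns the right-hand side into a vector minus itself,
    so no induction over the forces is needed.\<close>
  have "residual A \<pi> (0\<^sub>v n + (- 1) \<cdot>\<^sub>v 0\<^sub>v n) = residual A \<pi> (0\<^sub>v n) + (- 1) \<cdot>\<^sub>v residual A \<pi> (0\<^sub>v n)"
    by (rule residual_linear[OF A _ _ \<pi>]) auto
  moreover have "0\<^sub>v n + (- 1) \<cdot>\<^sub>v 0\<^sub>v n = (0\<^sub>v n :: 'a vec)" by auto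
  moreover have "residual A \<pi> (0\<^sub>v n) + (- 1) \<cdot>\<^sub>v residual A \<pi> (0\<^sub>v n) = 0\<^sub>v n"
    using A by (intro eq_vecI) auto
  ultimately show ?thesis by simp
qed

text \<open>The argument is a combination of columns of \<open>A\<close>, and linearity lets the
  induction split off one column at a time. For \<open>W = Z\<close> and a terminal
  \<open>t\<close>, the sum is entry \<open>t\<close> of the core matrix times
  \<open>y\<close>.\<close>

lemma residual_mult_mat_vec:
  assumes A: "A \<in> carrier_mat n n" and \<pi>: "\<forall>e\<in>set \<pi>. fst e < n"
    and W: "W \<subseteq> {..<n}" and t: "t < n"
  shows "residual A \<pi> (A *\<^sub>v vec n (\<lambda>i. if i \<in> W then y i else 0)) $ t
    = (\<Sum>v\<in>W. residual A \<pi> (col A v) $ t * y v)"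
  using finite_subset[OF W finite_lessThan] W
proof (induction W)
  case empty
  have "A *\<^sub>v vec n (\<lambda>i. 0) = 0\<^sub>v n"
    using A by (intro eq_vecI) (auto simp: scalar_prod_def)
  then show ?case using residual_zero[OF A \<pi>] t by simp
next
  case (insert v W)
  let ?h = "\<lambda>W. vec n (\<lambda>i. if i \<in> W then y i else 0)"
  have v: "v < n" using insert.prems by simp
  have h: "?h (insert v W) = ?h W + y v \<cdot>\<^sub>v unit_vec n v"
    using insert.hyps v by (intro eq_vecI) (auto simp: unit_vec_def)
  have "A *\<^sub>v ?h (insert v W) = A *\<^sub>v ?h W + y v \<cdot>\<^sub>v (A *\<^sub>v unit_vec n v)"
    unfolding h using A
    by (simp add: mult_add_distrib_mat_vec[of _ n n] mult_mat_vec[of _ n n])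
  also have "A *\<^sub>v unit_vec n v = col A v"
    using A v by (intro eq_vecI) auto
  finally have "residual A \<pi> (A *\<^sub>v ?h (insert v W))
      = residual A \<pi> (A *\<^sub>v ?h W) + y v \<cdot>\<^sub>v residual A \<pi> (col A v)"
    using residual_linear[OF A _ _ \<pi>] A by (metis col_carrier_vec mult_mat_vec_carrier v vec_carrier)
  then show ?case
    using insert A t by (simp add: algebra_simps)
qed

section \<open>Combinatorics of a chronological list of forces\<close>

lemma chronological_forces_nth:
  assumes "chronological_forces A Z \<pi>" and "j < length \<pi>"
  defines "S \<equiv> Z \<union> snd ` set (take j \<pi>)"
  shows "fst (\<pi> ! j) \<in> S" and "out_nbrs A (fst (\<pi> ! j)) - S = {snd (\<pi> ! j)}"
  using assms(1,2) unfolding chronological_forces_def Let_def S_def set_map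
  by (elim conjE allE[where x = j], simp)+

lemma chronological_forces_fresh:
  assumes "chronological_forces A Z \<pi>" and "j \<le> k" and "k < length \<pi>"
  shows "snd (\<pi> ! k) \<notin> Z \<union> snd ` set (take j \<pi>)"
proof -
  have "distinct (map snd \<pi>)" and "snd ` set \<pi> = verts A - Z"
    using assms(1) by (auto simp: chronological_forces_def)
  moreover have "snd (\<pi> ! k) \<noteq> snd (\<pi> ! i)" if "i < j" for i
    using \<open>distinct (map snd \<pi>)\<close> that assms(2,3) by (auto simp: distinct_conv_nth)
  ultimately show ?thesis
    using assms(2,3) nth_mem[OF assms(3)] by (fastforce simp: in_set_conv_nth)
qed

text \<open>The parent is already blue, hence a vertex, and the forced vertex is one of its
  out-neighbours. The nonzero entry is the divisor in \<open>forcing_update\<close>.\<close>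

lemma chronological_forces_bounds:
  assumes "A \<in> carrier_mat n n" and "chronological_forces A Z \<pi>" and "Z \<subseteq> verts A"
    and "j < length \<pi>"
  shows "fst (\<pi> ! j) < n" and "snd (\<pi> ! j) < n" and "A $$ (\<pi> ! j) \<noteq> 0"
proof -
  have V: "verts A = {..<n}" using assms(1) by (auto simp: verts_def)
  have "snd ` set \<pi> \<subseteq> verts A" using assms(2) by (auto simp: chronological_forces_def)
  then have "Z \<union> snd ` set (take j \<pi>) \<subseteq> verts A"
    using assms(3) set_take_subset[of j \<pi>] by blast
  then show "fst (\<pi> ! j) < n" using chronological_forces_nth(1)[OF assms(2,4)] V by blast
  have "snd (\<pi> ! j) \<in> out_nbrs A (fst (\<pi> ! j))"
    using chronological_forces_nth(2)[OF assms(2,4)] by blast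
  then show "snd (\<pi> ! j) < n" "A $$ (\<pi> ! j) \<noteq> 0"
    by (auto simp: out_nbrs_def arcs_def V)
qed

text \<open>\<open>out_nbrs\<close> ignores the diagonal of \<open>A\<close>, but a parent is already blue when it forces, so it
  differs from every vertex forced later.\<close>

lemma chronological_forces_later_entry:
  assumes A: "A \<in> carrier_mat n n" and cf: "chronological_forces A Z \<pi>" and Z: "Z \<subseteq> verts A"
    and jk: "j < k" "k < length \<pi>"
  shows "A $$ (fst (\<pi> ! j), snd (\<pi> ! k)) = 0"
proof -
  have j: "j < length \<pi>" using jk by simp
  define S where "S = Z \<union> snd ` set (take j \<pi>)"
  have p: "fst (\<pi> ! j) \<in> S" and out: "out_nbrs A (fst (\<pi> ! j)) - S = {snd (\<pi> ! j)}"
    using chronological_forces_nth[OF cf j] by (simp_all add: S_def)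
  \<comment> \<open>Taking \<open>Suc j\<close> rather than \<open>j\<close> also excludes the
    vertex forced at step \<open>j\<close>, the only out-neighbour of the parent outside
    \<open>S\<close>.\<close>
  have "snd (\<pi> ! k) \<notin> Z \<union> snd ` set (take (Suc j) \<pi>)"
    using chronological_forces_fresh[OF cf, of "Suc j" k] jk by simp
  then have "snd (\<pi> ! k) \<notin> insert (snd (\<pi> ! j)) S"
    using j by (simp add: S_def take_Suc_conv_app_nth)
  then have u: "snd (\<pi> ! k) \<noteq> snd (\<pi> ! j)" "snd (\<pi> ! k) \<notin> S" by simp_all
  have "snd (\<pi> ! k) \<notin> out_nbrs A (fst (\<pi> ! j))"
  proof
    assume "snd (\<pi> ! k) \<in> out_nbrs A (fst (\<pi> ! j))"
    then have "snd (\<pi> ! k) \<in> out_nbrs A (fst (\<pi> ! j)) - S" using u(2) by (rule DiffI)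
    then show False unfolding out using u(1) by simp
  qed
  moreover have "fst (\<pi> ! j) \<noteq> snd (\<pi> ! k)" using p u(2) by metis
  moreover have "fst (\<pi> ! j) < n" "snd (\<pi> ! k) < n"
    using chronological_forces_bounds(1)[OF A cf Z j] chronological_forces_bounds(2)[OF A cf Z jk(2)] .
  ultimately show ?thesis using A by (auto simp: out_nbrs_def arcs_def verts_def)
qed

section \<open>Row equations and zero entries after forcing\<close>

text \<open>The two claims need a joint induction: the update subtracts the whole product
  \<open>row A p \<bullet> x\<close>, including the term at \<open>u\<close>, so it solves row
  \<open>p\<close> exactly only because the entry at the still unforced \<open>u\<close> is
  0.\<close>

lemma forcing_prefix_invariant:
  fixes b :: "'a::field vec"
  assumes A: "A \<in> carrier_mat n n" and cf: "chronological_forces A Z \<pi>" and Z: "Z \<subseteq> verts A"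
    and "k \<le> length \<pi>"
  defines "x \<equiv> \<lambda>k. fold (forcing_update A b) (take k \<pi>) (0\<^sub>v n)"
  shows "(\<forall>i<n. i \<notin> snd ` set (take k \<pi>) \<longrightarrow> x k $ i = 0)
    \<and> (\<forall>j<k. row A (fst (\<pi> ! j)) \<bullet> x k = b $ fst (\<pi> ! j))"
  using assms(4)
proof (induction k)
  case 0
  then show ?case by (simp add: x_def)
next
  case (Suc k)
  obtain p u where pu: "\<pi> ! k = (p, u)" by (cases "\<pi> ! k")
  have k: "k < length \<pi>" using Suc.prems by simp
  have take: "take (Suc k) \<pi> = take k \<pi> @ [(p, u)]"
    using k pu by (simp add: take_Suc_conv_app_nth)
  have xc: "x k \<in> carrier_vec n" by (rule carrier_vecI) (simp add: x_def)
  have step: "x (Suc k) = forcing_update A b (p, u) (x k)" by (simp add: x_def take)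
  have IH: "\<forall>i<n. i \<notin> snd ` set (take k \<pi>) \<longrightarrow> x k $ i = 0"
    "\<forall>j<k. row A (fst (\<pi> ! j)) \<bullet> x k = b $ fst (\<pi> ! j)"
    using Suc by auto
  have bd: "p < n" "u < n" "A $$ (p, u) \<noteq> 0"
    using chronological_forces_bounds[OF A cf Z k] pu by auto
  have xu: "x k $ u = 0"
    using chronological_forces_fresh[OF cf order_refl k] IH(1) bd pu by simp
  have "row A (fst (\<pi> ! j)) \<bullet> x (Suc k) = b $ fst (\<pi> ! j)" if "j < Suc k" for j
  proof (cases "j = k")
    case True
    then show ?thesis
      using scalar_prod_forcing_update[OF A xc bd(1,2), of b p] bd xu by (simp add: step pu)
  next
    case False
    then have "j < k" using that by simp
    \<comment> \<open>The new value at \<open>u\<close> is invisible to the rows of earlier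
      parents.\<close>
    moreover have "A $$ (fst (\<pi> ! j), u) = 0"
      using chronological_forces_later_entry[OF A cf Z \<open>j < k\<close> k] pu by simp
    moreover have "fst (\<pi> ! j) < n"
      using chronological_forces_bounds(1)[OF A cf Z, of j] \<open>j < k\<close> k by simp
    ultimately show ?thesis
      using scalar_prod_forcing_update[OF A xc _ bd(2), of "fst (\<pi> ! j)" b p] IH(2) by (simp add: step)
  qed
  moreover have "x (Suc k) $ i = 0" if "i < n" "i \<notin> snd ` set (take (Suc k) \<pi>)" for i
    using that IH(1) xc by (auto simp: step take forcing_update_index)
  ultimately show ?case by blast
qed

text \<open>Forcing starts from 0 and writes only outside \<open>Z\<close>. Hence adding a forced
  vector to the extension of \<open>y\<close> keeps the prescribed values on
  \<open>Z\<close>.\<close>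

lemma forcing_eq_0_on_zero_forcing_set:
  assumes A: "A \<in> carrier_mat n n" and cf: "chronological_forces A Z \<pi>" and Z: "Z \<subseteq> verts A"
    and v: "v \<in> Z"
  shows "forcing A \<pi> b $ v = 0"
proof -
  have "v < n" using Z v A by (auto simp: verts_def)
  moreover have "v \<notin> snd ` set \<pi>" using cf v by (auto simp: chronological_forces_def)
  ultimately show ?thesis
    using forcing_prefix_invariant[OF A cf Z order_refl, of b] A by (simp add: forcing_def)
qed

lemma residual_eq_0_off_terminals:
  assumes A: "A \<in> carrier_mat n n" and cf: "chronological_forces A Z \<pi>" and Z: "Z \<subseteq> verts A"
    and w: "w < n" "w \<notin> terminals A \<pi>"
  shows "residual A \<pi> b $ w = 0"
proof -
  obtain j where "j < length \<pi>" "w = fst (\<pi> ! j)"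
    using w A by (auto simp: terminals_def verts_def in_set_conv_nth image_iff)
  then have "row A w \<bullet> forcing A \<pi> b = b $ w"
    using forcing_prefix_invariant[OF A cf Z order_refl, of b] A by (simp add: forcing_def)
  then show ?thesis using A w by (simp add: residual_index)
qed

theorem theorem5:
  fixes A :: "'a::field mat" and n :: nat and Z :: "nat set"
    and \<pi> :: "(nat \<times> nat) list" and b :: "'a vec" and y :: "nat \<Rightarrow> 'a"
  assumes "A \<in> carrier_mat n n"
    and "zero_forcing_set A Z"
    and "chronological_forces A Z \<pi>"
    and "b \<in> carrier_vec n"
    and "\<exists>x\<in>carrier_vec n. A *\<^sub>v x = b"
    and "y \<in> Z \<rightarrow>\<^sub>E UNIV"
    and "mult_indexed (terminals A \<pi>) Z (core_matrix A Z \<pi>) y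
           = restrict_vec (residual A \<pi> b) (terminals A \<pi>)"
  shows "\<exists>x\<in>carrier_vec n. A *\<^sub>v x = b \<and> restrict_vec x Z = y"
proof -
  note A = assms(1) and cf = assms(3) and b = assms(4)
  have Z: "Z \<subseteq> verts A" using assms(2) by (simp add: zero_forcing_set_def)
  then have Zn: "Z \<subseteq> {..<n}" using A by (auto simp: verts_def)
  have \<pi>: "\<forall>e\<in>set \<pi>. fst e < n"
    using chronological_forces_bounds(1)[OF A cf Z] by (metis in_set_conv_nth)
  define h where "h = vec n (\<lambda>i. if i \<in> Z then y i else 0)"
  \<comment> \<open>The difference is written with the scalar -1 to match the form of
    \<open>residual_linear\<close>.\<close>
  define c where "c = b + (- 1) \<cdot>\<^sub>v (A *\<^sub>v h)"
  have h: "h \<in> carrier_vec n" by (simp add: h_def)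
  have Ah: "A *\<^sub>v h \<in> carrier_vec n" using A h by simp
  have c: "c \<in> carrier_vec n" using b Ah by (simp add: c_def)
  have "residual A \<pi> c $ t = 0" if t: "t < n" for t
  proof (cases "t \<in> terminals A \<pi>")
    case True
    have "residual A \<pi> (A *\<^sub>v h) $ t = (\<Sum>v\<in>Z. residual A \<pi> (col A v) $ t * y v)"
      unfolding h_def by (rule residual_mult_mat_vec[OF A \<pi> Zn t])
    \<comment> \<open>This is the hypothesis on \<open>y\<close>, an equality of extensional
      functions, evaluated at the terminal \<open>t\<close>.\<close>
    also have "\<dots> = residual A \<pi> b $ t"
      using fun_cong[OF assms(7), of t] True
      by (simp add: mult_indexed_def core_matrix_def restrict_vec_def)
    finally show ?thesis
      using residual_linear[OF A b Ah \<pi>, of "- 1"] A t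
      by (simp add: c_def)
  next
    case False
    then show ?thesis by (rule residual_eq_0_off_terminals[OF A cf Z t])
  qed
  then have Ac: "row A t \<bullet> forcing A \<pi> c = c $ t" if "t < n" for t
    using residual_index[OF A that, of \<pi> c] that by simp
  define x where "x = h + forcing A \<pi> c"
  have "A *\<^sub>v x = A *\<^sub>v h + A *\<^sub>v forcing A \<pi> c"
    unfolding x_def using A h by (simp add: mult_add_distrib_mat_vec[of _ n n])
  also have "\<dots> = b"
  proof (rule eq_vecI)
    fix t assume "t < dim_vec b"
    then have t: "t < n" using b by simp
    then have "c $ t = b $ t - row A t \<bullet> h" using A b by (simp add: c_def)
    then show "(A *\<^sub>v h + A *\<^sub>v forcing A \<pi> c) $ t = b $ t" using A t by (simp add: Ac)
  qed (use A b in simp)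
  finally have "A *\<^sub>v x = b" .
  moreover have "x \<in> carrier_vec n" using A h by (simp add: x_def)
  moreover have "restrict_vec x Z = y"
  proof
    fix v
    have "v < n" if "v \<in> Z" using that Zn by auto
    \<comment> \<open>On \<open>Z\<close> the forced summand is 0 and \<open>h\<close> equals
      \<open>y\<close>; off \<open>Z\<close> both sides are \<open>undefined\<close>, by the
      extensionality of \<open>y\<close>.\<close>
    then show "restrict_vec x Z v = y v"
      using A forcing_eq_0_on_zero_forcing_set[OF A cf Z, of v c] PiE_arb[OF assms(6), of v]
      by (auto simp: restrict_vec_def x_def h_def)
  qed
  ultimately show ?thesis by blast
qed

end
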